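(* There exist $x_1,\dots,x_{d-1}\in\mathbb{F}_{q^d}^\times$ such that, putting $x_d=1$ and $P_i=\prod_{j=0}^{i}(1-x_{d-j}^{1-q}\tau)=(1-x_d^{1-q}\tau)(1-x_{d-1}^{1-q}\tau)\cdots(1-x_{d-i}^{1-q}\tau)\in\mathbb{F}_{q^d}\{\tau\}$: (a) for every $i\in\{0,\dots,d-1\}$ there is an $\mathbb{F}_q$-linearly independent set $\{y^{(0)}_{d-i},\dots,y^{(i)}_{d-i}\}\subset\overline{\mathbb{F}}_q$ (with $y^{(0)}_d=1$) such that $\ker\varphi_{P_i}=\bigoplus_{j=0}^{i}\mathbb{F}_q\,y^{(j)}_{d-i}$; (b) in $\mathbb{F}_{q^d}\{\tau\}$ one has the factorization $$1-t=(1-\tau)(1-x_{d-1}^{1-q}\tau)\cdots(1-x_1^{1-q}\tau).$$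
   Context: $\mathbb{F}_{q^d}\{\tau\}\subset\overline{\mathbb{F}}_q\{\tau\}$ are skew polynomial rings with $\tau\lambda=\lambda^q\tau$, and $t=\tau^d$. For $g=\sum_{i=0}^n a_i\tau^i\in\overline{\mathbb{F}}_q\{\tau\}$, $\varphi_g:\overline{\mathbb{F}}_q\to\overline{\mathbb{F}}_q$ is the $\mathbb{F}_q$-linear map $x\mapsto\sum_{i=0}^n a_ix^{q^i}$. *)

theory Defs
  imports "HOL-Library.Cardinality" "HOL-Algebra.Algebraic_Closure_Type" "HOL-Algebra.Sylow"
begin

subsection \<open>The \<open>q\<close>-Frobenius\<close>

text \<open>
  The field \<open>\<F>\<^sub>q\<close> is an arbitrary type \<^typ>\<open>'a :: finite_field\<close>, so that \<open>q = CARD('a)\<close>;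
  its algebraic closure is \<^typ>\<open>'a alg_closure\<close>.
\<close>

lemma card_finite_field_eq_CHAR_power:
  "\<exists>n. CARD('a :: finite_field) = CHAR('a) ^ n"
proof -
  define G :: "'a monoid" where "G = \<lparr>carrier = UNIV, monoid.mult = (+), one = 0\<rparr>"
  have G: "Group.group G"
    by (rule groupI) (auto simp: G_def add.assoc intro: exI[of _ "- x" for x])
  have pow: "x [^]\<^bsub>G\<^esub> (n :: nat) = of_nat n * x" for x n
    by (induction n) (auto simp: G_def nat_pow_def algebra_simps)
  have "r = CHAR('a)" if r: "prime r" "r dvd CARD('a)" for r :: nat
  proof -
    obtain m where m: "CARD('a) = r ^ 1 * m"
      using r(2) by auto
    have "\<exists>S. subgroup S G \<and> card S = r ^ 1"
      by (rule sylow_thm[OF r(1) G, of 1 m]) (use m in \<open>auto simp: G_def Coset.order_def\<close>)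
    then obtain S where S: "subgroup S G" "card S = r"
      by auto
    interpret G: Group.group G by (rule G)
    have fin: "finite S"
      by (rule finite_subset[of _ UNIV]) auto
    have "card S > 1"
      using S(2) r(1) prime_gt_1_nat by simp
    hence "\<not> S \<subseteq> {0}"
      using card_mono[of "{0 :: 'a}" S] by auto
    then obtain x where x: "x \<in> S" "x \<noteq> 0"
      by blast
    interpret S: Group.group "G\<lparr>carrier := S\<rparr>"
      using S(1) G by (rule subgroup.subgroup_is_group)
    have "x [^]\<^bsub>G\<lparr>carrier := S\<rparr>\<^esub> Coset.order (G\<lparr>carrier := S\<rparr>) = \<one>\<^bsub>G\<lparr>carrier := S\<rparr>\<^esub>"
      by (rule S.pow_order_eq_1) (use x fin in auto)
    hence "x [^]\<^bsub>G\<^esub> r = \<one>\<^bsub>G\<^esub>"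
      using S(2) by (simp add: Coset.order_def nat_pow_def)
    hence "of_nat r * x = 0"
      by (simp only: pow) (simp add: G_def)
    hence "of_nat r = (0 :: 'a)"
      using x by simp
    hence "CHAR('a) dvd r"
      by (simp add: of_nat_eq_0_iff_char_dvd)
    thus ?thesis
      using r(1) CHAR_prime primes_dvd_imp_eq by metis
  qed
  hence "prime_factors CARD('a) \<subseteq> {CHAR('a)}"
    by (auto simp: prime_factors_dvd)
  hence "prime_factorization CARD('a) = replicate_mset (count (prime_factorization CARD('a)) CHAR('a)) CHAR('a)"
    by (intro multiset_eqI) (auto simp: not_in_iff[symmetric])
  moreover have "prod_mset (prime_factorization CARD('a)) = CARD('a)"
    by (simp add: prod_mset_prime_factorization_nat)
  ultimately show ?thesis
    by (metis prod_mset_replicate_mset)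
qed

lemma q_power_add:
  fixes x y :: "'a :: finite_field alg_closure"
  shows "(x + y) ^ CARD('a) ^ n = x ^ CARD('a) ^ n + y ^ CARD('a) ^ n"
proof -
  obtain m where m: "CARD('a) = CHAR('a) ^ m"
    using card_finite_field_eq_CHAR_power by blast
  show ?thesis
    by (rule freshmans_dream'[where n = "m * n"]) (simp_all add: m power_mult)
qed

lemma q_power_0 [simp]: "(0 :: 'b :: semiring_1) ^ CARD('a :: finite) ^ n = 0"
  by (simp add: power_0_left)

lemma q_power_sum:
  fixes f :: "'b \<Rightarrow> 'a :: finite_field alg_closure"
  shows "(\<Sum>x\<in>A. f x) ^ CARD('a) ^ n = (\<Sum>x\<in>A. f x ^ CARD('a) ^ n)"
  by (induction A rule: infinite_finite_induct) (auto simp: q_power_add)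


text \<open>
  \<open>\<F>\<^bsub>q^d\<^esub>\<close> is represented by a subfield of the closure with \<open>q^d\<close> elements.
\<close>

lemma ex_subfield_card_q_power:
  assumes "d > 0"
  shows "\<exists>L :: 'a :: finite_field alg_closure set.
           subfield L ring_of_type_algebra \<and> card L = CARD('a) ^ d"
proof -
  let ?q = "CARD('a)"
  define L where "L = {x :: 'a alg_closure. x ^ ?q ^ d = x}"
  obtain m where m: "CARD('a) = CHAR('a) ^ m"
    using card_finite_field_eq_CHAR_power by blast
  have q1: "?q > 1"
    using card_mono[of "UNIV :: 'a set" "{0, 1}"] by simp
  hence "m > 0"
    using m by (auto intro!: Nat.gr0I)
  have qd: "?q ^ d > 1"
    using q1 assms by (metis one_less_power)
  define p where "p = Polynomial.monom (1 :: 'a alg_closure) (?q ^ d) - Polynomial.monom 1 1"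
  have deg: "Polynomial.degree p = ?q ^ d"
    unfolding p_def diff_conv_add_uminus using qd
    by (subst degree_add_eq_left) (auto simp: Polynomial.degree_monom_eq)
  have "of_nat (?q ^ d) = (0 :: 'a alg_closure)"
    using \<open>m > 0\<close> assms by (subst of_nat_eq_0_iff_char_dvd) (auto simp: m simp flip: power_mult)
  hence pd: "pderiv p = - 1"
    by (simp add: p_def pderiv_diff pderiv_monom monom_eq_1_iff)
  have p0: "p \<noteq> 0"
    using deg qd by auto
  have sqf: "Polynomial.order x p \<le> 1" for x
  proof (rule ccontr)
    assume "\<not> Polynomial.order x p \<le> 1"
    hence "[:-x, 1:] ^ 2 dvd p"
      by (intro order_divides[THEN iffD2]) auto
    then obtain r where "p = [:-x, 1:] * ([:-x, 1:] * r)"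
      unfolding dvd_def power2_eq_square mult.assoc by blast
    hence "poly (pderiv p) x = 0"
      by (simp only: pderiv_mult) simp
    thus False
      by (simp add: pd)
  qed
  have roots: "{x. poly p x = 0} = L"
    by (auto simp: L_def p_def poly_monom)
  obtain A where A: "size A = Polynomial.degree p"
      "p = Polynomial.smult (Polynomial.lead_coeff p) (\<Prod>x\<in>#A. [:-x, 1:])"
    using alg_closed_imp_factorization[OF p0] by blast
  have lc: "Polynomial.lead_coeff p \<noteq> 0"
    using p0 by simp
  have "proots p = proots (\<Prod>x\<in>#A. [:-x, 1:])"
    using lc A(2) by (metis proots_smult)
  also have "\<dots> = A"
  proof -
    have nz: "(\<Prod>x\<in>#B. [:-x, 1:]) \<noteq> 0" for B :: "'a alg_closure multiset"
      by (auto simp: prod_mset_zero_iff)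
    show ?thesis
    proof (induction A)
      case (add x B)
      have "proots ([:-x, 1:] * (\<Prod>x\<in>#B. [:-x, 1:])) = proots [:-x, 1:] + B"
        using proots_mult[of "[:-x, 1:]", OF _ nz[of B]] add.IH by simp
      thus ?case
        by (simp del: mult_pCons_left)
    qed simp
  qed
  finally have cnt: "Polynomial.order x p = count A x" for x
    using count_proots[OF p0] by metis
  have "count A x = 1" if "x \<in># A" for x
    using that sqf[of x] cnt[of x] by (auto simp: le_Suc_eq count_eq_zero_iff)
  hence "card (set_mset A) = size A"
    by (simp add: size_multiset_overloaded_eq)
  moreover have "set_mset A = L"
    using p0 by (auto simp: roots [symmetric] order_root cnt)
  ultimately have "card L = ?q ^ d"
    using A(1) deg by simp
  moreover have "subfield L ring_of_type_algebra"
  proof -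
    let ?R = "ring_of_type_algebra :: 'a alg_closure ring"
    interpret R: field ?R
      by (rule field_from_type_algebra)
    have R: "carrier ?R = UNIV" "\<one>\<^bsub>?R\<^esub> = 1" "\<zero>\<^bsub>?R\<^esub> = 0" "monoid.mult ?R = (*)" "add ?R = (+)"
      by (simp_all add: ring_of_type_algebra_def)
    have neg: "\<ominus>\<^bsub>?R\<^esub> x = - x" for x
      by (rule R.minus_equality) (simp_all add: R)
    have inv: "inv\<^bsub>?R\<^esub> x = inverse x" if "x \<noteq> 0" for x
      by (rule R.comm_inv_char) (use that in \<open>simp_all add: R\<close>)
    show ?thesis
    proof (rule R.subfieldI')
      show "subring L ?R"
      proof (rule R.subringI)
        fix x assume "x \<in> L"
        hence "x + (- x) ^ ?q ^ d = 0"
          using q_power_add[of x "- x" d] by (simp add: L_def)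
        thus "\<ominus>\<^bsub>?R\<^esub> x \<in> L"
          by (simp add: neg L_def eq_neg_iff_add_eq_0 add.commute)
      qed (auto simp: R L_def q_power_add power_mult_distrib)
    qed (auto simp: inv R L_def power_inverse)
  qed
  ultimately show ?thesis
    by blast
qed


subsection \<open>The skew polynomial ring over the algebraic closure\<close>

typedef (overloaded) 'a skew_poly =
  "{f :: nat \<Rightarrow> 'a :: finite_field alg_closure. finite {n. f n \<noteq> 0}}"
  morphisms skew_coeff Abs_skew_poly
  by (rule exI[of _ "\<lambda>_. 0"]) auto

lemma skew_poly_eqI: "(\<And>n. skew_coeff f n = skew_coeff g n) \<Longrightarrow> f = g"
  by (simp add: fun_eq_iff flip: skew_coeff_inject)

lemma finite_skew_support [simp]: "finite {n. skew_coeff f n \<noteq> 0}"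
  using skew_coeff[of f] by simp

text \<open>The multiplication is determined by \<open>(a \<tau>\<^sup>i) (b \<tau>\<^sup>j) = a b\<^bsup>q^i\<^esup> \<tau>\<^bsup>i+j\<^esup>\<close>.\<close>

instantiation skew_poly :: (finite_field) ring_1
begin

definition zero_skew_poly :: "'a skew_poly" where
  "0 = Abs_skew_poly (\<lambda>_. 0)"

definition one_skew_poly :: "'a skew_poly" where
  "1 = Abs_skew_poly (\<lambda>n. if n = 0 then 1 else 0)"

definition plus_skew_poly :: "'a skew_poly \<Rightarrow> 'a skew_poly \<Rightarrow> 'a skew_poly" where
  "f + g = Abs_skew_poly (\<lambda>n. skew_coeff f n + skew_coeff g n)"

definition uminus_skew_poly :: "'a skew_poly \<Rightarrow> 'a skew_poly" where
  "- f = Abs_skew_poly (\<lambda>n. - skew_coeff f n)"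

definition minus_skew_poly :: "'a skew_poly \<Rightarrow> 'a skew_poly \<Rightarrow> 'a skew_poly" where
  "f - g = Abs_skew_poly (\<lambda>n. skew_coeff f n - skew_coeff g n)"

definition times_skew_poly :: "'a skew_poly \<Rightarrow> 'a skew_poly \<Rightarrow> 'a skew_poly" where
  "f * g = Abs_skew_poly (\<lambda>n. \<Sum>i=0..n. skew_coeff f i * skew_coeff g (n - i) ^ CARD('a) ^ i)"

lemma skew_coeff_0: "skew_coeff (0 :: 'a skew_poly) n = 0"
  by (simp add: zero_skew_poly_def Abs_skew_poly_inverse)

lemma skew_coeff_1: "skew_coeff (1 :: 'a skew_poly) n = (if n = 0 then 1 else 0)"
  by (simp add: one_skew_poly_def Abs_skew_poly_inverse)

lemma skew_coeff_add: "skew_coeff (f + g :: 'a skew_poly) n = skew_coeff f n + skew_coeff g n"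
proof -
  have "finite {n. skew_coeff f n + skew_coeff g n \<noteq> 0}"
    by (rule finite_subset[of _ "{n. skew_coeff f n \<noteq> 0} \<union> {n. skew_coeff g n \<noteq> 0}"]) auto
  thus ?thesis
    by (simp add: plus_skew_poly_def Abs_skew_poly_inverse)
qed

lemma skew_coeff_uminus: "skew_coeff (- f :: 'a skew_poly) n = - skew_coeff f n"
  by (simp add: uminus_skew_poly_def Abs_skew_poly_inverse)

lemma skew_coeff_diff: "skew_coeff (f - g :: 'a skew_poly) n = skew_coeff f n - skew_coeff g n"
proof -
  have "finite {n. skew_coeff f n - skew_coeff g n \<noteq> 0}"
    by (rule finite_subset[of _ "{n. skew_coeff f n \<noteq> 0} \<union> {n. skew_coeff g n \<noteq> 0}"]) auto
  thus ?thesis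
    by (simp add: minus_skew_poly_def Abs_skew_poly_inverse)
qed

lemma skew_coeff_mult:
  "skew_coeff (f * g :: 'a skew_poly) n =
     (\<Sum>i=0..n. skew_coeff f i * skew_coeff g (n - i) ^ CARD('a) ^ i)"
proof -
  let ?c = "\<lambda>n. \<Sum>i=0..n. skew_coeff f i * skew_coeff g (n - i) ^ CARD('a) ^ i"
  let ?S = "(\<lambda>(i, j). i + j) ` ({n. skew_coeff f n \<noteq> 0} \<times> {n. skew_coeff g n \<noteq> 0})"
  have "?c n = 0" if "n \<notin> ?S" for n
  proof (rule sum.neutral, rule ballI, rule ccontr)
    fix i assume i: "i \<in> {0..n}" "skew_coeff f i * skew_coeff g (n - i) ^ CARD('a) ^ i \<noteq> 0"
    hence "skew_coeff f i \<noteq> 0" "skew_coeff g (n - i) \<noteq> 0"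
      by auto
    hence "n \<in> ?S"
      using i(1) by (intro image_eqI[of _ _ "(i, n - i)"]) auto
    thus False
      using that by simp
  qed
  hence "{n. ?c n \<noteq> 0} \<subseteq> ?S"
    by blast
  hence "finite {n. ?c n \<noteq> 0}"
    by (rule finite_subset) (intro finite_imageI finite_cartesian_product finite_skew_support)
  thus ?thesis
    by (simp add: times_skew_poly_def Abs_skew_poly_inverse)
qed

instance
proof
  fix f g h :: "'a skew_poly"
  show "f * g * h = f * (g * h)"
  proof (rule skew_poly_eqI)
    fix n
    let ?F = "\<lambda>i j k. skew_coeff f i * skew_coeff g j ^ CARD('a) ^ i * skew_coeff h k ^ CARD('a) ^ (i + j)"
    have "skew_coeff (f * g * h) n = (\<Sum>k=0..n. \<Sum>i=0..k. ?F i (k - i) (n - k))"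
      by (simp add: skew_coeff_mult sum_distrib_right)
    also have "\<dots> = (\<Sum>k=0..n. \<Sum>i=0..n-k. ?F k i (n - k - i))"
      by (rule fps_mult_assoc_lemma)
    also have "\<dots> = skew_coeff (f * (g * h)) n"
      unfolding skew_coeff_mult q_power_sum sum_distrib_left power_mult_distrib
        power_mult [symmetric] power_add [symmetric]
      by (simp only: mult.assoc add.commute)
    finally show "skew_coeff (f * g * h) n = skew_coeff (f * (g * h)) n" .
  qed
  show "1 * f = f"
  proof (rule skew_poly_eqI)
    fix n
    have "skew_coeff (1 * f) n = (\<Sum>i=0..n. if i = 0 then skew_coeff f n else 0)"
      unfolding skew_coeff_mult
      by (rule sum.cong) (auto simp: skew_coeff_1)
    thus "skew_coeff (1 * f) n = skew_coeff f n"
      by simp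
  qed
  show "f * 1 = f"
  proof (rule skew_poly_eqI)
    fix n
    have "skew_coeff (f * 1) n = (\<Sum>i=0..n. if i = n then skew_coeff f n else 0)"
      unfolding skew_coeff_mult
      by (rule sum.cong) (auto simp: skew_coeff_1)
    thus "skew_coeff (f * 1) n = skew_coeff f n"
      by simp
  qed
  show "(f + g) * h = f * h + g * h"
    by (rule skew_poly_eqI)
       (simp add: skew_coeff_mult skew_coeff_add algebra_simps sum.distrib)
  show "f * (g + h) = f * g + f * h"
    by (rule skew_poly_eqI)
       (simp add: skew_coeff_mult skew_coeff_add algebra_simps sum.distrib q_power_add)
  show "(0 :: 'a skew_poly) \<noteq> 1"
  proof
    assume "(0 :: 'a skew_poly) = 1"
    hence "skew_coeff (0 :: 'a skew_poly) 0 = skew_coeff 1 0"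
      by (rule arg_cong)
    thus False
      by (simp add: skew_coeff_1 skew_coeff_0)
  qed
qed (rule skew_poly_eqI; simp add: skew_coeff_add skew_coeff_0
       skew_coeff_uminus skew_coeff_diff algebra_simps)+

end

definition skew_const :: "'a :: finite_field alg_closure \<Rightarrow> 'a skew_poly" where
  "skew_const c = Abs_skew_poly (\<lambda>n. if n = 0 then c else 0)"

definition skew_tau :: "'a :: finite_field skew_poly" (\<open>\<tau>\<close>) where
  "\<tau> = Abs_skew_poly (\<lambda>n. if n = 1 then 1 else 0)"

lemma skew_coeff_const: "skew_coeff (skew_const c) n = (if n = 0 then c else 0)"
  by (simp add: skew_const_def Abs_skew_poly_inverse)

lemma skew_coeff_tau: "skew_coeff \<tau> n = (if n = 1 then 1 else 0)"
  by (simp add: skew_tau_def Abs_skew_poly_inverse)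

lemma skew_tau_mult_const: "\<tau> * skew_const c = skew_const (c ^ CARD('a)) * \<tau>"
  for c :: "'a :: finite_field alg_closure"
proof (rule skew_poly_eqI)
  fix n
  have "skew_coeff (\<tau> * skew_const c) n =
          (\<Sum>i=0..n. if i = 1 then (if n = 1 then c ^ CARD('a) else 0) else 0)"
    unfolding skew_coeff_mult
    by (rule sum.cong) (auto simp: skew_coeff_tau skew_coeff_const power_0_left)
  also have "\<dots> = (\<Sum>i=0..n. if i = 0 then (if n = 1 then c ^ CARD('a) else 0) else 0)"
    by simp
  also have "\<dots> = skew_coeff (skew_const (c ^ CARD('a)) * \<tau>) n"
    unfolding skew_coeff_mult
    by (rule sum.cong) (auto simp: skew_coeff_tau skew_coeff_const)
  finally show "skew_coeff (\<tau> * skew_const c) n = skew_coeff (skew_const (c ^ CARD('a)) * \<tau>) n" .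
qed

definition skew_polys_over :: "'a :: finite_field alg_closure set \<Rightarrow> 'a skew_poly set" where
  "skew_polys_over L = {g. \<forall>n. skew_coeff g n \<in> L}"

definition skew_eval :: "'a :: finite_field skew_poly \<Rightarrow> 'a alg_closure \<Rightarrow> 'a alg_closure" (\<open>\<phi>\<close>) where
  "\<phi> g x = (\<Sum>i | skew_coeff g i \<noteq> 0. skew_coeff g i * x ^ CARD('a) ^ i)"


subsection \<open>The algebraic closure as a vector space over the base field\<close>

definition ac_scale :: "'a :: field \<Rightarrow> 'a alg_closure \<Rightarrow> 'a alg_closure" where
  "ac_scale c x = to_ac c * x"

global_interpretation ac: vector_space ac_scale
  by standard (simp_all add: ac_scale_def algebra_simps)

lemma linear_skew_eval: "Vector_Spaces.linear ac_scale ac_scale (\<phi> g)"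
proof -
  have "to_ac (c :: 'a) ^ CARD('a) ^ i = to_ac c" for c i
    by (metis finite_field_power_card_power_eq_same to_ac_power)
  hence "\<phi> g (ac_scale c x) = ac_scale c (\<phi> g x)" for c x
    by (simp add: skew_eval_def ac_scale_def power_mult_distrib sum_distrib_left mult_ac)
  moreover have "\<phi> g (x + y) = \<phi> g x + \<phi> g y" for x y
    by (simp add: skew_eval_def q_power_add distrib_left sum.distrib)
  ultimately show ?thesis
    by (intro Vector_Spaces.linear.intro module_hom.intro module_hom_axioms.intro
          ac.vector_space_axioms ac.module_axioms)
qed

definition ac_line :: "'a :: field alg_closure \<Rightarrow> 'a alg_closure set" where
  "ac_line y = range (\<lambda>c. ac_scale c y)"

definition is_direct_sum :: "'b :: ab_group_add set \<Rightarrow> 'i set \<Rightarrow> ('i \<Rightarrow> 'b set) \<Rightarrow> bool" where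
  "is_direct_sum V I W \<longleftrightarrow>
     V = {\<Sum>j\<in>I. w j | w. \<forall>j\<in>I. w j \<in> W j} \<and>
     (\<forall>w. (\<forall>j\<in>I. w j \<in> W j) \<and> (\<Sum>j\<in>I. w j) = 0 \<longrightarrow> (\<forall>j\<in>I. w j = 0))"


subsection \<open>The factors and their partial products\<close>

definition skew_factor :: "'a :: finite_field alg_closure \<Rightarrow> 'a skew_poly" where
  "skew_factor x = 1 - skew_const (x powi (1 - int CARD('a))) * \<tau>"

text \<open>The product is not commutative: the factors are ordered by increasing \<open>j\<close>, left to right.\<close>

definition skew_partial_prod ::
  "nat \<Rightarrow> (nat \<Rightarrow> 'a :: finite_field alg_closure) \<Rightarrow> nat \<Rightarrow> 'a skew_poly" where
  "skew_partial_prod d x i = (\<Prod>j\<leftarrow>[0..<Suc i]. skew_factor (x (d - j)))"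

end

theory Submission
  imports Defs
begin

text \<open>
  Write \<open>1 - t = (1 - \<tau>) A\<close> with \<open>A = 1 + \<tau> + \<dots> + \<tau>\<^bsup>d-1\<^esup>\<close>. On \<open>L = \<F>\<^bsub>q^d\<^esub>\<close> the map \<open>\<phi> A\<close> is the
  trace to \<open>\<F>\<^sub>q\<close>, so its kernel in \<open>L\<close> has at least \<open>q\<^bsup>d-1\<^esup>\<close> elements. A nonzero \<open>x\<close> in the kernel
  of \<open>\<phi> f\<close> makes \<open>f\<close> divisible on the right by \<open>1 - x\<^bsup>1-q\<^esup>\<tau>\<close>, and since this factor maps \<open>L\<close> to \<open>L\<close>
  with kernel \<open>\<F>\<^sub>q x\<close>, the quotient still has at least a \<open>q\<close>-th part of the kernel inside \<open>L\<close>. Hence \<open>A\<close>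
  splits completely into such factors. Over the algebraic closure each factor is surjective, so
  appending one on the right adds the line \<open>\<F>\<^sub>q x\<close> to preimages of a basis of the previous kernel.
\<close>

section \<open>Evaluation of skew polynomials\<close>

lemma skew_eval_eq_sum_atMost:
  assumes "\<And>n. n > N \<Longrightarrow> skew_coeff g n = 0"
  shows "\<phi> (g :: 'a :: finite_field skew_poly) x = (\<Sum>i\<le>N. skew_coeff g i * x ^ CARD('a) ^ i)"
  unfolding skew_eval_def
  by (rule sum.mono_neutral_left) (use assms in \<open>auto intro: leI\<close>)

lemma skew_coeff_bound:
  obtains N where "\<And>n. n > N \<Longrightarrow> skew_coeff g n = 0"
proof -
  have "\<forall>n > Max (insert 0 {n. skew_coeff g n \<noteq> 0}). skew_coeff g n = 0"
    by (metis Max_ge finite_insert finite_skew_support insertCI leD mem_Collect_eq)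
  thus thesis using that by blast
qed

text \<open>The q-power map is additive, so a (b x^(q^j))^(q^i) = a b^(q^i) x^(q^(i+j)), which is
  the twist built into the skew product.\<close>

lemma skew_eval_mult: "\<phi> (f * g) x = \<phi> f (\<phi> g x)"
  for f g :: "'a :: finite_field skew_poly"
proof -
  obtain M where M: "\<And>n. n > M \<Longrightarrow> skew_coeff f n = 0"
    using skew_coeff_bound by blast
  obtain N where N: "\<And>n. n > N \<Longrightarrow> skew_coeff g n = 0"
    using skew_coeff_bound by blast
  let ?F = "\<lambda>i j. skew_coeff f i * skew_coeff g j ^ CARD('a) ^ i * x ^ CARD('a) ^ (i + j)"
  have MN: "skew_coeff (f * g) n = 0" if "n > M + N" for n
    unfolding skew_coeff_mult
  proof (rule sum.neutral, rule ballI)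
    fix i assume "i \<in> {0..n}"
    show "skew_coeff f i * skew_coeff g (n - i) ^ CARD('a) ^ i = 0"
      using M[of i] N[of "n - i"] that by (cases "i > M") auto
  qed
  have "\<phi> (f * g) x = (\<Sum>n\<le>M + N. \<Sum>i\<le>n. ?F i (n - i))"
    by (subst skew_eval_eq_sum_atMost[OF MN])
       (auto simp: skew_coeff_mult sum_distrib_right atLeast0AtMost)
  also have "\<dots> = (\<Sum>(i,j)\<in>{(i,j). i + j \<le> M + N}. ?F i j)"
    by (rule sum.triangle_reindex_eq [symmetric])
  \<comment> \<open>The triangle contains the rectangle, and outside the rectangle one of the two
    coefficients vanishes.\<close>
  also have "\<dots> = (\<Sum>(i,j)\<in>{..M}\<times>{..N}. ?F i j)"
  proof (rule sum.mono_neutral_right)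
    show "finite {(i, j). i + j \<le> M + N}"
      by (rule finite_subset[of _ "{..M+N}\<times>{..M+N}"]) auto
    show "\<forall>p\<in>{(i, j). i + j \<le> M + N} - {..M} \<times> {..N}. (case p of (i, j) \<Rightarrow> ?F i j) = 0"
      using M N by (auto intro: leI)
  qed auto
  also have "\<dots> = (\<Sum>i\<le>M. \<Sum>j\<le>N. ?F i j)"
    by (rule sum.cartesian_product [symmetric])
  also have "\<dots> = \<phi> f (\<phi> g x)"
    by (simp add: skew_eval_eq_sum_atMost[OF M] skew_eval_eq_sum_atMost[OF N] q_power_sum
          sum_distrib_left power_mult_distrib power_add mult.assoc flip: power_mult)
       (simp add: mult.commute)
  finally show ?thesis .
qed

lemma skew_eval_diff_right: "\<phi> g (x - y) = \<phi> g x - \<phi> g y"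
  using linear_skew_eval[of g] by (metis Vector_Spaces.linear.axioms(3) module_hom.diff)

lemma skew_eval_add_right: "\<phi> g (x + y) = \<phi> g x + \<phi> g y"
  using linear_skew_eval[of g] by (metis Vector_Spaces.linear.axioms(3) module_hom.add)

lemma skew_eval_0_right [simp]: "\<phi> g 0 = 0"
  using skew_eval_diff_right[of g 0 0] by simp

lemma skew_eval_scale: "\<phi> g (ac_scale c x) = ac_scale c (\<phi> g x)"
  using linear_skew_eval[of g] by (metis Vector_Spaces.linear.axioms(3) module_hom.scale)

lemma skew_eval_sum_right: "\<phi> g (\<Sum>i\<in>A. h i) = (\<Sum>i\<in>A. \<phi> g (h i))"
  by (induction A rule: infinite_finite_induct) (auto simp: skew_eval_add_right)

lemma skew_coeff_const_mult: "skew_coeff (skew_const c * f) n = c * skew_coeff f n"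
proof -
  have "skew_coeff (skew_const c * f) n = (\<Sum>i=0..n. if i = 0 then c * skew_coeff f n else 0)"
    unfolding skew_coeff_mult by (rule sum.cong) (auto simp: skew_coeff_const)
  thus ?thesis by simp
qed

lemma skew_coeff_mult_const_tau:
  fixes g :: "'a :: finite_field skew_poly"
  shows "skew_coeff (g * (skew_const c * \<tau>)) n =
           (if n = 0 then 0 else skew_coeff g (n - 1) * c ^ CARD('a) ^ (n - 1))"
proof -
  \<comment> \<open>The guard \<open>n \<noteq> 0\<close> is needed because truncated subtraction
    gives \<open>n - 1 = 0\<close> at \<open>n = 0\<close>.\<close>
  have "skew_coeff (g * (skew_const c * \<tau>)) n =
          (\<Sum>i=0..n. if i = n - 1 \<and> n \<noteq> 0 then skew_coeff g (n - 1) * c ^ CARD('a) ^ (n - 1) else 0)"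
    unfolding skew_coeff_mult[of g]
    by (rule sum.cong) (auto simp: skew_coeff_const_mult skew_coeff_tau)
  thus ?thesis by (auto simp: sum.If_cases)
qed

lemma skew_coeff_tau_power:
  "skew_coeff (\<tau> ^ k :: 'a :: finite_field skew_poly) n = (if n = k then 1 else 0)"
proof (induction k arbitrary: n)
  case (Suc k)
  have 1: "skew_const 1 * \<tau> = (\<tau> :: 'a skew_poly)"
    by (rule skew_poly_eqI) (simp add: skew_coeff_const_mult)
  have "skew_coeff (\<tau> ^ k * (skew_const 1 * \<tau>) :: 'a skew_poly) n = (if n = Suc k then 1 else 0)"
    by (subst skew_coeff_mult_const_tau) (auto simp: Suc)
  thus ?case by (simp add: 1 power_Suc2 del: power_Suc)
qed (simp add: skew_coeff_1)

lemma skew_coeff_sum: "skew_coeff (\<Sum>i\<in>A. h i) n = (\<Sum>i\<in>A. skew_coeff (h i) n)"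
  by (induction A rule: infinite_finite_induct) (auto simp: skew_coeff_0 skew_coeff_add)

lemma skew_coeff_factor:
  "skew_coeff (skew_factor x) n =
     (if n = 0 then 1 else if n = 1 then - (x powi (1 - int CARD('a))) else 0)"
  for x :: "'a :: finite_field alg_closure"
  by (simp add: skew_factor_def skew_coeff_diff skew_coeff_1 skew_coeff_const_mult skew_coeff_tau)

lemma skew_eval_factor:
  "\<phi> (skew_factor x) z = z - x powi (1 - int CARD('a)) * z ^ CARD('a)"
  for x :: "'a :: finite_field alg_closure"
  by (subst skew_eval_eq_sum_atMost[where N = 1]) (auto simp: skew_coeff_factor)

lemma skew_eval_one_minus_tau_power: "\<phi> (1 - \<tau> ^ d) z = z - z ^ CARD('a) ^ d" if "d > 0"
  for z :: "'a :: finite_field alg_closure"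
proof -
  have "\<phi> (1 - \<tau> ^ d) z = (\<Sum>i\<le>d. (if i = 0 then z else 0) - (if i = d then z ^ CARD('a) ^ d else 0))"
    by (subst skew_eval_eq_sum_atMost[where N = d])
       (use that in \<open>auto simp: skew_coeff_diff skew_coeff_1 skew_coeff_tau_power intro!: sum.cong\<close>)
  thus ?thesis by (simp add: sum_subtractf)
qed

section \<open>The kernel of a single factor\<close>

lemma CARD_finite_field_gt_1: "CARD('a :: finite_field) > 1"
  using card_mono[of "UNIV :: 'a set" "{0, 1}"] by simp

text \<open>The base field already supplies q roots of the polynomial z^q - z of degree q, so there
  are no others.\<close>

lemma q_power_eq_self_iff: "z ^ CARD('a) = z \<longleftrightarrow> z \<in> range to_ac"
  for z :: "'a :: finite_field alg_closure"
proof -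
  define p where "p = Polynomial.monom (1 :: 'a alg_closure) CARD('a) - Polynomial.monom 1 1"
  have deg: "Polynomial.degree p = CARD('a)"
    unfolding p_def diff_conv_add_uminus using CARD_finite_field_gt_1[where 'a = 'a]
    by (subst degree_add_eq_left) (auto simp: Polynomial.degree_monom_eq)
  hence p0: "p \<noteq> 0" by auto
  have roots: "{z. poly p z = 0} = {z. z ^ CARD('a) = z}"
    by (auto simp: p_def poly_monom)
  have "range to_ac = {z :: 'a alg_closure. z ^ CARD('a) = z}"
  proof (rule card_seteq)
    show "finite {z :: 'a alg_closure. z ^ CARD('a) = z}"
      using poly_roots_finite[OF p0] roots by simp
    have "to_ac c ^ CARD('a) = to_ac c" for c :: 'a
      by (metis finite_field_power_card_eq_same to_ac_power)
    thus "range to_ac \<subseteq> {z :: 'a alg_closure. z ^ CARD('a) = z}" by auto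
    have "card {z :: 'a alg_closure. z ^ CARD('a) = z} \<le> CARD('a)"
      using card_poly_roots_bound[OF p0] roots deg by simp
    thus "card {z :: 'a alg_closure. z ^ CARD('a) = z} \<le> card (range (to_ac :: 'a \<Rightarrow> _))"
      by (simp add: card_image inj_on_def)
  qed
  thus ?thesis by blast
qed

lemma powi_one_minus: "x powi (1 - int n) = x / x ^ n" if "x \<noteq> (0 :: 'b :: field)"
  using that by (simp add: power_int_diff)

text \<open>Substituting z = u x turns z = x^(1-q) z^q into u = u^q, whose solutions form the base
  field.\<close>

lemma skew_eval_factor_eq_0_iff:
  fixes x :: "'a :: finite_field alg_closure"
  assumes "x \<noteq> 0"
  shows "\<phi> (skew_factor x) z = 0 \<longleftrightarrow> (\<exists>c. z = ac_scale c x)"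
proof -
  have "\<phi> (skew_factor x) z = 0 \<longleftrightarrow> (z / x) ^ CARD('a) = z / x"
    using assms by (auto simp: skew_eval_factor powi_one_minus field_simps)
  also have "\<dots> \<longleftrightarrow> (\<exists>c. z / x = to_ac c)"
    by (auto simp: q_power_eq_self_iff)
  also have "\<dots> \<longleftrightarrow> (\<exists>c. z = ac_scale c x)"
    using assms by (auto simp: ac_scale_def field_simps)
  finally show ?thesis .
qed

text \<open>For fixed w the equation in z is polynomial of degree q with nonzero leading
  coefficient, so it has a root in the closure.\<close>

lemma skew_eval_factor_surj:
  fixes x :: "'a :: finite_field alg_closure"
  assumes "x \<noteq> 0"
  obtains z where "\<phi> (skew_factor x) z = w"
proof -
  let ?c = "x powi (1 - int CARD('a))"
  define p where "p = Polynomial.monom (- ?c) CARD('a) + [:- w, 1:]"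
  have "?c \<noteq> 0" using assms by simp
  hence "Polynomial.degree p = CARD('a)"
    unfolding p_def using CARD_finite_field_gt_1[where 'a = 'a]
    by (subst degree_add_eq_left) (auto simp: Polynomial.degree_monom_eq)
  then obtain z where "poly p z = 0"
    using alg_closed_imp_poly_has_root[of p] by auto
  hence "\<phi> (skew_factor x) z = w"
    by (simp add: p_def poly_monom skew_eval_factor algebra_simps)
  thus thesis by (rule that)
qed

section \<open>Kernels of products of factors\<close>

text \<open>Independence is phrased through coefficient families, which also rules out repetitions
  among the \<open>y j\<close>. The clause for \<open>i = 0\<close> records the normalization of the
  first basis.\<close>

lemma ex_basis_kernel_partial_prod:
  fixes x :: "nat \<Rightarrow> 'a :: finite_field alg_closure"
  assumes "\<And>j. j \<le> i \<Longrightarrow> x (d - j) \<noteq> 0"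
  shows "\<exists>y :: nat \<Rightarrow> 'a alg_closure. (i = 0 \<longrightarrow> y 0 = x d) \<and>
    (\<forall>z. \<phi> (skew_partial_prod d x i) z = 0 \<longleftrightarrow> (\<exists>c. z = (\<Sum>j\<le>i. ac_scale (c j) (y j)))) \<and>
    (\<forall>c. (\<Sum>j\<le>i. ac_scale (c j) (y j)) = 0 \<longrightarrow> (\<forall>j\<le>i. c j = 0))"
  using assms
proof (induction i)
  case 0
  have x: "x d \<noteq> 0" using 0[of 0] by simp
  have P: "skew_partial_prod d x 0 = skew_factor (x d)"
    by (simp add: skew_partial_prod_def)
  show ?case
    by (rule exI[of _ "\<lambda>_. x d"])
       (use x in \<open>auto simp: P skew_eval_factor_eq_0_iff ac_scale_def to_ac_eq_0_iff intro: exI[of _ "\<lambda>_. c" for c]\<close>)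
next
  case (Suc i)
  obtain y where
    y: "\<And>z. \<phi> (skew_partial_prod d x i) z = 0 \<longleftrightarrow> (\<exists>c. z = (\<Sum>j\<le>i. ac_scale (c j) (y j)))"
       "\<And>c. (\<Sum>j\<le>i. ac_scale (c j) (y j)) = 0 \<Longrightarrow> \<forall>j\<le>i. c j = 0"
  proof -
    have "x (d - j) \<noteq> 0" if "j \<le> i" for j
      using Suc.prems that by simp
    from Suc.IH[OF this] show thesis using that by blast
  qed
  define u where "u = x (d - Suc i)"
  have u: "u \<noteq> 0" using Suc.prems[of "Suc i"] by (simp add: u_def)
  let ?F = "\<phi> (skew_factor u)"
  \<comment> \<open>Old basis vectors are replaced by preimages under the new factor; the new index
    receives the generator \<open>u\<close> of that factor's kernel.\<close>
  define y' where "y' = (\<lambda>j. if j = Suc i then u else SOME z. ?F z = y j)"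
  have Fy': "?F (y' j) = y j" if "j \<le> i" for j
  proof -
    have "\<exists>z. ?F z = y j" using skew_eval_factor_surj[OF u] by blast
    from someI_ex[OF this] show ?thesis using that by (simp add: y'_def)
  qed
  have Fu: "?F u = 0"
    by (subst skew_eval_factor_eq_0_iff[OF u]) (auto simp: ac_scale_def intro: exI[of _ 1])
  have F_sum: "?F (\<Sum>j\<le>Suc i. ac_scale (c j) (y' j)) = (\<Sum>j\<le>i. ac_scale (c j) (y j))" for c
  proof -
    have "?F (y' (Suc i)) = 0" by (simp add: y'_def Fu)
    thus ?thesis
      by (simp add: skew_eval_sum_right skew_eval_add_right skew_eval_scale Fy')
  qed
  have P: "\<phi> (skew_partial_prod d x (Suc i)) z = \<phi> (skew_partial_prod d x i) (?F z)" for z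
    by (simp add: skew_partial_prod_def u_def skew_eval_mult)
  have "\<phi> (skew_partial_prod d x (Suc i)) z = 0 \<longleftrightarrow>
          (\<exists>c. z = (\<Sum>j\<le>Suc i. ac_scale (c j) (y' j)))" for z
  proof
    assume "\<phi> (skew_partial_prod d x (Suc i)) z = 0"
    then obtain c where c: "?F z = (\<Sum>j\<le>i. ac_scale (c j) (y j))"
      using y(1) P by auto
    let ?s = "\<lambda>c. \<Sum>j\<le>Suc i. ac_scale (c j) (y' j)"
    \<comment> \<open>The lift of the combination has the same image as \<open>z\<close>. Its
      coefficient at \<open>u\<close> is set to 0 first, so that the scalar \<open>b\<close> of the
      difference can be inserted there.\<close>
    have "?F (z - ?s (c(Suc i := 0))) = 0"
      unfolding skew_eval_diff_right F_sum c by simp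
    then obtain b where "z - ?s (c(Suc i := 0)) = ac_scale b u"
      using skew_eval_factor_eq_0_iff[OF u] by blast
    hence "z = ?s (c(Suc i := b))"
      by (simp add: y'_def algebra_simps)
    thus "\<exists>c. z = ?s c" by blast
  next
    assume "\<exists>c. z = (\<Sum>j\<le>Suc i. ac_scale (c j) (y' j))"
    then obtain c where "?F z = (\<Sum>j\<le>i. ac_scale (c j) (y j))"
      using F_sum by blast
    thus "\<phi> (skew_partial_prod d x (Suc i)) z = 0"
      unfolding P y(1) by blast
  qed
  moreover have "\<forall>j\<le>Suc i. c j = 0" if c: "(\<Sum>j\<le>Suc i. ac_scale (c j) (y' j)) = 0" for c
  proof -
    \<comment> \<open>Applying the new factor kills the term in \<open>u\<close> and leaves a
      relation among the old \<open>y j\<close>.\<close>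
    have *: "\<forall>j\<le>i. c j = 0"
      using F_sum[of c] y(2)[of c] c by simp
    hence "ac_scale (c (Suc i)) u = 0"
      using c by (simp add: y'_def)
    hence "c (Suc i) = 0" using u by simp
    thus ?thesis using * by (auto simp: le_Suc_eq)
  qed
  ultimately show ?case by (intro exI[of _ y']) simp
qed

lemma (in vector_space) independent_family:
  assumes "finite I"
    and zero: "\<And>c. (\<Sum>j\<in>I. scale (c j) (y j)) = 0 \<Longrightarrow> \<forall>j\<in>I. c j = 0"
  shows "inj_on y I" "independent (y ` I)"
proof -
  show inj: "inj_on y I"
  proof (rule inj_onI, rule ccontr)
    fix a b assume ab: "a \<in> I" "b \<in> I" "y a = y b" "a \<noteq> b"
    \<comment> \<open>A repetition \<open>y a = y b\<close> would yield the nontrivial relation y_a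
      - y_b = 0.\<close>
    let ?c = "\<lambda>j. (if j = a then 1 else 0) - (if j = b then 1 else 0)"
    have "scale (?c j) (y j) = (if j = a then y a else 0) - (if j = b then y b else 0)" for j
      by auto
    hence "(\<Sum>j\<in>I. scale (?c j) (y j)) = 0"
      using ab \<open>finite I\<close> by (simp add: sum_subtractf)
    thus False using zero[of ?c] ab by auto
  qed
  show "independent (y ` I)"
  proof (rule independent_if_scalars_zero)
    fix f v assume "(\<Sum>v\<in>y ` I. scale (f v) v) = 0" "v \<in> y ` I"
    thus "f v = 0"
      using zero[of "f \<circ> y"] by (auto simp: sum.reindex[OF inj])
  qed (use \<open>finite I\<close> in simp)
qed

section \<open>Splitting off factors on the right\<close>

text \<open>Subtracting a fixed point of a nonempty fibre injects that fibre into the kernel inside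
  \<open>S\<close>.\<close>

lemma card_le_card_image_mult_card_kernel:
  fixes h :: "'b :: ab_group_add \<Rightarrow> 'c :: ab_group_add"
  assumes fin: "finite S" and diff: "\<And>x y. x \<in> S \<Longrightarrow> y \<in> S \<Longrightarrow> x - y \<in> S"
    and h: "\<And>x y. h (x - y) = h x - h y"
  shows "card S \<le> card (h ` S) * card {s \<in> S. h s = 0}"
proof -
  have fibre: "card {s \<in> S. h s = c} \<le> card {s \<in> S. h s = 0}" if "c \<in> h ` S" for c
  proof -
    obtain s0 where s0: "s0 \<in> S" "h s0 = c" using \<open>c \<in> h ` S\<close> by auto
    show ?thesis
      by (rule card_inj_on_le[where f = "\<lambda>s. s - s0"])
         (use s0 fin diff h in \<open>auto simp: inj_on_def\<close>)
  qed
  have "S = (\<Union>c\<in>h ` S. {s \<in> S. h s = c})" by auto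
  hence "card S \<le> (\<Sum>c\<in>h ` S. card {s \<in> S. h s = c})"
    using card_UN_le[of "h ` S" "\<lambda>c. {s \<in> S. h s = c}"] fin by simp
  also have "\<dots> \<le> card (h ` S) * card {s \<in> S. h s = 0}"
    using sum_bounded_above[OF fibre] by simp
  finally show ?thesis .
qed

text \<open>Since the factor has constant coefficient 1, a right quotient always exists as a formal
  power series. The condition \<open>\<phi> f x = 0\<close> makes it terminate, one degree below the
  bound for \<open>f\<close>.\<close>

lemma skew_factor_right_dvd:
  fixes f :: "'a :: finite_field skew_poly"
  assumes x: "x \<noteq> 0" "\<phi> f x = 0" and deg: "\<And>n. n > Suc N \<Longrightarrow> skew_coeff f n = 0"
  obtains g where "f = g * skew_factor x" "skew_coeff g 0 = skew_coeff f 0"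
    "\<And>n. n > N \<Longrightarrow> skew_coeff g n = 0"
proof -
  let ?q = "CARD('a)"
  let ?s = "\<lambda>n. \<Sum>j\<le>n. skew_coeff f j * x ^ ?q ^ j"
  have s0: "?s n = 0" if "n > N" for n
    using skew_eval_eq_sum_atMost[of n f x] deg x that by simp
  \<comment> \<open>Multiplying the recursion \<open>g\<^sub>n = f\<^sub>n + g\<^sub>n\<^sub>-\<^sub>1 c\<^bsup>q^(n-1)\<^esup>\<close>, \<open>c = x\<^bsup>1-q\<^esup>\<close>, by \<open>x\<^bsup>q^n\<^esup>\<close> makes it telescope.\<close>
  define g where "g = Abs_skew_poly (\<lambda>n. ?s n / x ^ ?q ^ n)"
  have "finite {n. ?s n / x ^ ?q ^ n \<noteq> 0}"
    by (rule finite_subset[of _ "{..N}"]) (use s0 in \<open>auto intro: leI\<close>)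
  hence g: "skew_coeff g n = ?s n / x ^ ?q ^ n" for n
    by (simp add: g_def Abs_skew_poly_inverse)
  have "f = g * skew_factor x"
  proof (rule skew_poly_eqI)
    fix n
    have c: "(x powi (1 - int ?q)) ^ ?q ^ m = x ^ ?q ^ m / x ^ ?q ^ Suc m" for m
      using x by (simp add: powi_one_minus power_divide flip: power_mult)
    have *: "skew_coeff (g * skew_factor x) k = skew_coeff g k -
        (if k = 0 then 0 else skew_coeff g (k - 1) * (x powi (1 - int ?q)) ^ ?q ^ (k - 1))" for k
      by (simp add: skew_factor_def right_diff_distrib skew_coeff_diff skew_coeff_mult_const_tau)
    show "skew_coeff f n = skew_coeff (g * skew_factor x) n"
    proof (cases n)
      case 0
      show ?thesis using x unfolding * by (simp add: g 0)
    next
      case (Suc m)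
      have "skew_coeff (g * skew_factor x) n =
              ?s (Suc m) / x ^ ?q ^ Suc m - ?s m / x ^ ?q ^ m * (x ^ ?q ^ m / x ^ ?q ^ Suc m)"
        unfolding * g Suc by (simp only: c nat.distinct if_False diff_Suc_1)
      also have "\<dots> = (?s (Suc m) - ?s m) / x ^ ?q ^ Suc m"
        using x by (simp add: diff_divide_distrib)
      also have "\<dots> = skew_coeff f n"
        using x by (simp add: Suc)
      finally show ?thesis by simp
    qed
  qed
  moreover have "skew_coeff g 0 = skew_coeff f 0"
    using x by (simp add: g)
  moreover have "skew_coeff g n = 0" if "n > N" for n
    using s0[OF that] by (simp add: g)
  ultimately show thesis by (rule that)
qed

section \<open>Finite subfields of a field\<close>

lemma subfield_type_algebra_closed:
  fixes L :: "'b :: field set"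
  assumes "subfield L ring_of_type_algebra"
  shows "0 \<in> L" "1 \<in> L" "\<And>x y. x \<in> L \<Longrightarrow> y \<in> L \<Longrightarrow> x + y \<in> L"
    "\<And>x y. x \<in> L \<Longrightarrow> y \<in> L \<Longrightarrow> x - y \<in> L" "\<And>x y. x \<in> L \<Longrightarrow> y \<in> L \<Longrightarrow> x * y \<in> L"
    "\<And>x. x \<in> L \<Longrightarrow> inverse x \<in> L"
proof -
  let ?R = "ring_of_type_algebra :: 'b ring"
  interpret R: field ?R by (rule field_from_type_algebra)
  note L = subringE[OF subfieldE(1)[OF assms]]
  have R: "carrier ?R = UNIV" "\<one>\<^bsub>?R\<^esub> = 1" "\<zero>\<^bsub>?R\<^esub> = 0" "monoid.mult ?R = (*)" "add ?R = (+)"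
    by (simp_all add: ring_of_type_algebra_def)
  have neg: "\<ominus>\<^bsub>?R\<^esub> x = - x" for x
    by (rule R.minus_equality) (simp_all add: R)
  have inv: "inv\<^bsub>?R\<^esub> x = inverse x" if "x \<noteq> 0" for x
    by (rule R.comm_inv_char) (use that in \<open>simp_all add: R\<close>)
  show 0: "0 \<in> L" using L(2) R by simp
  show "1 \<in> L" using L(3) R by simp
  show add: "x + y \<in> L" if "x \<in> L" "y \<in> L" for x y
    using L(7)[of x y] that R by simp
  show "x * y \<in> L" if "x \<in> L" "y \<in> L" for x y
    using L(6)[of x y] that R by simp
  have "- x \<in> L" if "x \<in> L" for x
    using L(5)[of x] that neg by simp
  thus "x - y \<in> L" if "x \<in> L" "y \<in> L" for x y
    using add[of x "- y"] that by simp
  show "inverse x \<in> L" if "x \<in> L" for x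
    \<comment> \<open>No side condition on \<open>x\<close> is needed, because
      \<open>inverse 0 = 0\<close>.\<close>
    using R.subfield_m_inv(1)[OF assms, of x] that inv[of x] 0 by (cases "x = 0") (auto simp: R)
qed

text \<open>Multiplication by a nonzero z permutes the nonzero elements of \<open>L\<close>;
  comparing their products gives z^(|L|-1) = 1.\<close>

lemma power_card_finite_subfield:
  fixes L :: "'b :: field set"
  assumes "subfield L ring_of_type_algebra" "finite L" "z \<in> L"
  shows "z ^ card L = z"
proof (cases "z = 0")
  case False
  note L = subfield_type_algebra_closed[OF assms(1)]
  let ?U = "L - {0}"
  have bij: "bij_betw ((*) z) ?U ?U"
    by (rule bij_betw_byWitness[where f' = "\<lambda>u. inverse z * u"])
       (use False L(5,6) assms(3) in \<open>auto simp: mult.assoc [symmetric]\<close>)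
  have "(\<Prod>u\<in>?U. u) = (\<Prod>u\<in>?U. z * u)"
    by (rule prod.reindex_bij_betw[OF bij, symmetric])
  also have "\<dots> = z ^ card ?U * (\<Prod>u\<in>?U. u)"
    by (simp add: prod.distrib)
  finally have "z ^ card ?U = 1" using assms(2) by simp
  moreover have "card L = Suc (card ?U)"
    using card.remove[OF assms(2) L(1)] .
  ultimately show ?thesis by simp
next
  case True
  have "card L > 0" using assms by (auto simp: card_gt_0_iff)
  thus ?thesis using True by simp
qed

lemma powi_mem_subfield:
  assumes "subfield L ring_of_type_algebra" "x \<in> (L :: 'b :: field set)"
  shows "x ^ n \<in> L" "x powi k \<in> L"
proof -
  note L = subfield_type_algebra_closed[OF assms(1)]
  have *: "y ^ m \<in> L" if "y \<in> L" for y m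
    using that by (induction m) (auto intro: L)
  show "x ^ n \<in> L" "x powi k \<in> L"
    using assms(2) by (auto simp: power_int_def intro!: * L(6))
qed

section \<open>Complete splitting into linear factors over L\<close>

lemma ex_factorization:
  fixes f :: "'a :: finite_field skew_poly" and L :: "'a alg_closure set"
  assumes L: "subfield L ring_of_type_algebra" "finite L"
    and "skew_coeff f 0 = 1" "\<And>k. k > n \<Longrightarrow> skew_coeff f k = 0"
    and "card {z \<in> L. \<phi> f z = 0} \<ge> CARD('a) ^ n"
  shows "\<exists>xs. length xs = n \<and> set xs \<subseteq> L - {0} \<and> f = prod_list (map skew_factor xs)"
  using assms(3-)
proof (induction n arbitrary: f)
  case 0
  \<comment> \<open>The constant coefficient 1 is preserved by every division, so no scalar is left
    over at the end.\<close>
  have "f = 1"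
    by (rule skew_poly_eqI) (use 0 in \<open>auto simp: skew_coeff_1\<close>)
  thus ?case by simp
next
  case (Suc n)
  note cl = subfield_type_algebra_closed[OF L(1)]
  let ?q = "CARD('a)"
  let ?S = "{z \<in> L. \<phi> f z = 0}"
  have "card ?S > 1"
    using one_less_power[OF CARD_finite_field_gt_1[where 'a = 'a], of "Suc n"] Suc.prems(3) by linarith
  hence "\<not> ?S \<subseteq> {0}"
    using card_mono[of "{0}" ?S] by auto
  then obtain x where x: "x \<in> L" "\<phi> f x = 0" "x \<noteq> 0" by blast
  then obtain g where g: "f = g * skew_factor x" "skew_coeff g 0 = skew_coeff f 0"
      "\<And>k. k > n \<Longrightarrow> skew_coeff g k = 0"
    using skew_factor_right_dvd[of x f n] Suc.prems(2) by metis
  let ?F = "\<phi> (skew_factor x)"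
  let ?T = "{z \<in> L. \<phi> g z = 0}"
  have FL: "?F z \<in> L" if "z \<in> L" for z
    unfolding skew_eval_factor using that x(1) by (intro cl powi_mem_subfield[OF L(1)])
  \<comment> \<open>The new factor sends the roots of \<open>f\<close> in \<open>L\<close> to roots
    of \<open>g\<close> in \<open>L\<close>, at most q to one, so \<open>g\<close> keeps at least
    q^n of them and the induction can continue.\<close>
  have "?q * ?q ^ n \<le> card ?S" using Suc.prems(3) by simp
  also have "\<dots> \<le> card (?F ` ?S) * card {s \<in> ?S. ?F s = 0}"
    by (rule card_le_card_image_mult_card_kernel)
       (use L(2) cl in \<open>auto simp: skew_eval_diff_right\<close>)
  also have "\<dots> \<le> card ?T * ?q"
  proof (rule mult_le_mono)
    show "card (?F ` ?S) \<le> card ?T"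
      by (rule card_mono) (use L(2) FL in \<open>auto simp: g(1) skew_eval_mult\<close>)
    have "{s \<in> ?S. ?F s = 0} \<subseteq> range (\<lambda>c. ac_scale c x)"
      by (auto simp: skew_eval_factor_eq_0_iff[OF x(3)])
    thus "card {s \<in> ?S. ?F s = 0} \<le> ?q"
      by (rule surj_card_le[rotated]) simp
  qed
  finally have "?q ^ n \<le> card ?T"
    using CARD_finite_field_gt_1[where 'a = 'a] by (simp add: mult.commute)
  then obtain xs where "length xs = n" "set xs \<subseteq> L - {0}" "g = prod_list (map skew_factor xs)"
    using Suc.IH[of g] g Suc.prems(1) by auto
  thus ?case
    using g(1) x by (intro exI[of _ "xs @ [x]"]) auto
qed

lemma one_minus_tau_mult_sum: "(1 - \<tau>) * (\<Sum>i<d. \<tau> ^ i) = 1 - \<tau> ^ d"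
  by (simp add: sum_distrib_left left_diff_distrib sum_lessThan_telescope' flip: power_Suc)

lemma skew_factor_1: "skew_factor 1 = 1 - \<tau>"
  by (rule skew_poly_eqI)
     (simp add: skew_coeff_factor skew_coeff_diff skew_coeff_1 skew_coeff_tau)

lemma ex_factorization_one_minus_tau_power:
  fixes L :: "'a :: finite_field alg_closure set"
  assumes L: "subfield L ring_of_type_algebra" "card L = CARD('a) ^ d" and d: "d \<ge> 1"
  shows "\<exists>xs. length xs = d - 1 \<and> set xs \<subseteq> L - {0} \<and>
           1 - \<tau> ^ d = (1 - \<tau>) * prod_list (map skew_factor xs)"
proof -
  let ?q = "CARD('a)"
  define A :: "'a skew_poly" where "A = (\<Sum>i<d. \<tau> ^ i)"
  have q: "?q > 1" by (rule CARD_finite_field_gt_1)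
  have fin: "finite L"
    using L(2) q by (intro card_ge_0_finite) simp
  note cl = subfield_type_algebra_closed[OF L(1)]
  have A: "skew_coeff A n = (if n < d then 1 else 0)" for n
    by (simp add: A_def skew_coeff_sum skew_coeff_tau_power)
  \<comment> \<open>On \<open>L\<close> the map \<open>\<phi> A\<close> is the trace, so its values lie in \<open>ker (1 - \<tau>) = \<F>\<^sub>q\<close>.\<close>
  have "\<phi> A z \<in> range to_ac" if "z \<in> L" for z
  proof -
    have "\<phi> (skew_factor 1) (\<phi> A z) = \<phi> (1 - \<tau> ^ d) z"
      by (simp only: skew_factor_1 A_def one_minus_tau_mult_sum flip: skew_eval_mult)
    \<comment> \<open>As |L| = q^d, every z in \<open>L\<close> satisfies z^(q^d) = z.\<close>
    also have "\<dots> = 0"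
      using power_card_finite_subfield[OF L(1) fin that] d L(2)
      by (simp add: skew_eval_one_minus_tau_power)
    finally show ?thesis
      by (auto simp: skew_eval_factor_eq_0_iff ac_scale_def)
  qed
  hence "card (\<phi> A ` L) \<le> ?q"
    by (intro surj_card_le[where f = to_ac]) auto
  moreover have "card L \<le> card (\<phi> A ` L) * card {z \<in> L. \<phi> A z = 0}"
    by (rule card_le_card_image_mult_card_kernel) (use fin cl in \<open>auto simp: skew_eval_diff_right\<close>)
  ultimately have "?q ^ d \<le> ?q * card {z \<in> L. \<phi> A z = 0}"
    using L(2) mult_le_mono1[of "card (\<phi> A ` L)" ?q "card {z \<in> L. \<phi> A z = 0}"] by linarith
  moreover have "?q ^ d = ?q * ?q ^ (d - 1)"
    using d by (simp flip: power_Suc)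
  ultimately have "?q ^ (d - 1) \<le> card {z \<in> L. \<phi> A z = 0}"
    using q by simp
  \<comment> \<open>\<open>A\<close> has degree d - 1 and constant coefficient 1, so the root count
    just obtained is the one required for complete splitting.\<close>
  hence "\<exists>xs. length xs = d - 1 \<and> set xs \<subseteq> L - {0} \<and> A = prod_list (map skew_factor xs)"
    using d by (intro ex_factorization[OF L(1) fin]) (auto simp: A)
  thus ?thesis
    unfolding one_minus_tau_mult_sum[of d, symmetric] A_def by metis
qed

section \<open>Coefficients in L and the direct sum form of the kernels\<close>

lemma skew_polys_over_mult:
  assumes "subfield L ring_of_type_algebra" "f \<in> skew_polys_over L" "g \<in> skew_polys_over L"
  shows "f * g \<in> skew_polys_over L"
proof -
  note cl = subfield_type_algebra_closed[OF assms(1)]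
  have sum: "(\<Sum>i\<in>I. h i) \<in> L" if "\<And>i. i \<in> I \<Longrightarrow> h i \<in> L" for I :: "nat set" and h
    using that by (induction I rule: infinite_finite_induct) (auto intro: cl)
  show ?thesis
    using assms(2,3)
    by (auto simp: skew_polys_over_def skew_coeff_mult intro!: sum cl powi_mem_subfield[OF assms(1)])
qed

lemma skew_factor_in_skew_polys_over:
  assumes "subfield L ring_of_type_algebra" "x \<in> L"
  shows "skew_factor x \<in> skew_polys_over L"
proof -
  note cl = subfield_type_algebra_closed[OF assms(1)]
  have "- y \<in> L" if "y \<in> L" for y using cl(4)[OF cl(1) that] by simp
  thus ?thesis
    by (auto simp: skew_polys_over_def skew_coeff_factor intro!: cl powi_mem_subfield assms)
qed

lemma skew_partial_prod_in_skew_polys_over: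
  assumes L: "subfield L ring_of_type_algebra" and x: "\<And>j. j \<le> i \<Longrightarrow> x (d - j) \<in> L"
  shows "skew_partial_prod d x i \<in> skew_polys_over L"
  using x
proof (induction i)
  case (Suc i)
  have "skew_partial_prod d x (Suc i) = skew_partial_prod d x i * skew_factor (x (d - Suc i))"
    by (simp add: skew_partial_prod_def mult.assoc)
  thus ?case
    using Suc by (auto intro!: skew_polys_over_mult[OF L] skew_factor_in_skew_polys_over[OF L])
qed (auto simp: skew_partial_prod_def intro: skew_factor_in_skew_polys_over[OF L])

lemma is_direct_sum_ac_lines:
  fixes y :: "nat \<Rightarrow> 'a :: field alg_closure"
  assumes span: "\<And>z. z \<in> V \<longleftrightarrow> (\<exists>c. z = (\<Sum>j\<le>i. ac_scale (c j) (y j)))"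
    and indep: "\<And>c. (\<Sum>j\<le>i. ac_scale (c j) (y j)) = 0 \<Longrightarrow> \<forall>j\<le>i. c j = 0"
  shows "is_direct_sum V {0..i} (\<lambda>j. ac_line (y j))"
proof -
  \<comment> \<open>Choosing one scalar per index reduces both halves of the direct sum to
    statements about coefficient families.\<close>
  have scalars: "\<exists>c. \<forall>j\<in>{0..i}. w j = ac_scale (c j) (y j)" if "\<forall>j\<in>{0..i}. w j \<in> ac_line (y j)" for w
    using that unfolding ac_line_def by (intro bchoice) auto
  show ?thesis
    unfolding is_direct_sum_def
  proof (intro conjI allI impI)
    show "V = {\<Sum>j\<in>{0..i}. w j | w. \<forall>j\<in>{0..i}. w j \<in> ac_line (y j)}" (is "_ = ?W")
    proof (intro Set.set_eqI iffI)
      fix z assume "z \<in> V"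
      then obtain c where "z = (\<Sum>j\<le>i. ac_scale (c j) (y j))" using span by blast
      thus "z \<in> ?W"
        by (auto simp: ac_line_def atLeast0AtMost intro!: exI[of _ "\<lambda>j. ac_scale (c j) (y j)"])
    next
      fix z assume "z \<in> ?W"
      then obtain w where w: "z = (\<Sum>j\<in>{0..i}. w j)" "\<forall>j\<in>{0..i}. w j \<in> ac_line (y j)" by blast
      with scalars obtain c where "\<forall>j\<in>{0..i}. w j = ac_scale (c j) (y j)" by blast
      hence "z = (\<Sum>j\<le>i. ac_scale (c j) (y j))"
        using w(1) by (simp add: atLeast0AtMost)
      thus "z \<in> V" using span by blast
    qed
  next
    fix w assume w: "(\<forall>j\<in>{0..i}. w j \<in> ac_line (y j)) \<and> (\<Sum>j\<in>{0..i}. w j) = 0"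
    with scalars obtain c where c: "\<forall>j\<in>{0..i}. w j = ac_scale (c j) (y j)" by blast
    hence "\<forall>j\<le>i. c j = 0"
      using w by (intro indep) (simp add: atLeast0AtMost)
    thus "\<forall>j\<in>{0..i}. w j = 0" using c by simp
  qed
qed

text \<open>Any subfield \<open>L\<close> with q^d elements serves as the field of coefficients;
  \<open>ex_subfield_card_q_power\<close> provides one.\<close>

theorem theorem58:
  fixes d :: nat and L :: "'a :: finite_field alg_closure set"
  assumes "d \<ge> 1"
    and "subfield L ring_of_type_algebra" and "card L = CARD('a) ^ d"
  shows "\<exists>x :: nat \<Rightarrow> 'a alg_closure.
    (\<forall>k\<in>{1..d-1}. x k \<in> L - {0}) \<and> x d = 1 \<and>
    (\<forall>i\<in>{0..d-1}. skew_partial_prod d x i \<in> skew_polys_over L) \<and>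
    (\<exists>y :: nat \<Rightarrow> nat \<Rightarrow> 'a alg_closure. y d 0 = 1 \<and>
      (\<forall>i\<in>{0..d-1}.
        inj_on (y (d - i)) {0..i} \<and> ac.independent (y (d - i) ` {0..i}) \<and>
        is_direct_sum {z. \<phi> (skew_partial_prod d x i) z = 0} {0..i} (\<lambda>j. ac_line (y (d - i) j)))) \<and>
    (\<forall>k\<in>{1..d}. skew_factor (x k) \<in> skew_polys_over L) \<and>
    1 - \<tau> ^ d = (1 - \<tau>) * (\<Prod>k\<leftarrow>rev [1..<d]. skew_factor (x k))"
proof -
  note L = assms(2)
  obtain xs where xs: "length xs = d - 1" "set xs \<subseteq> L - {0}"
      "1 - \<tau> ^ d = (1 - \<tau>) * prod_list (map skew_factor xs)"
    using ex_factorization_one_minus_tau_power[OF assms(2,3,1)] by blast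
  \<comment> \<open>From left to right \<open>xs\<close> lists x_(d-1), ..., x_1, and lists are
    indexed from 0, hence the reversal and the shift. The value 1 at \<open>d\<close> makes 1 -
    \<tau> the first factor of every partial product.\<close>
  define x where "x = (\<lambda>k. if k = d then 1 else rev xs ! (k - 1))"
  have mem: "x k \<in> L - {0}" if k: "k \<in> {1..d}" for k
  proof (cases "k = d")
    case False
    hence "rev xs ! (k - 1) \<in> set (rev xs)"
      using k xs(1) by (intro nth_mem) auto
    thus ?thesis using False xs(2) by (auto simp: x_def)
  qed (simp add: x_def subfield_type_algebra_closed[OF L])
  have "map x [1..<d] = rev xs"
    by (rule nth_equalityI) (auto simp: xs(1) x_def)
  hence "map x (rev [1..<d]) = xs"
    by (simp add: rev_map [symmetric])
  hence prod: "(\<Prod>k\<leftarrow>rev [1..<d]. skew_factor (x k)) = prod_list (map skew_factor xs)"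
    by (metis (no_types, lifting) map_map comp_apply map_eq_conv)
  have "\<exists>y. (i = 0 \<longrightarrow> y 0 = 1) \<and> inj_on y {0..i} \<and> ac.independent (y ` {0..i}) \<and>
          is_direct_sum {z. \<phi> (skew_partial_prod d x i) z = 0} {0..i} (\<lambda>j. ac_line (y j))"
    if i: "i \<in> {0..d-1}" for i
  proof -
    have "x (d - j) \<noteq> 0" if "j \<le> i" for j
      using mem[of "d - j"] i that assms(1) by auto
    from ex_basis_kernel_partial_prod[of i x d, OF this] obtain y :: "nat \<Rightarrow> 'a alg_closure" where
      y: "i = 0 \<longrightarrow> y 0 = 1"
        "\<And>z. \<phi> (skew_partial_prod d x i) z = 0 \<longleftrightarrow> (\<exists>c. z = (\<Sum>j\<le>i. ac_scale (c j) (y j)))"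
        "\<And>c. (\<Sum>j\<le>i. ac_scale (c j) (y j)) = 0 \<Longrightarrow> \<forall>j\<le>i. c j = 0"
      by (auto simp: x_def)
    have "inj_on y {0..i}" "ac.independent (y ` {0..i})"
      using ac.independent_family[of "{0..i}" y] y(3) by (auto simp: atLeast0AtMost)
    moreover have "is_direct_sum {z. \<phi> (skew_partial_prod d x i) z = 0} {0..i} (\<lambda>j. ac_line (y j))"
      by (rule is_direct_sum_ac_lines) (use y(2,3) in simp_all)
    ultimately show ?thesis using y(1) by blast
  qed
  then obtain Y where Y: "\<And>i. i \<in> {0..d-1} \<Longrightarrow> (i = 0 \<longrightarrow> Y i 0 = 1) \<and> inj_on (Y i) {0..i} \<and>
      ac.independent (Y i ` {0..i}) \<and>
      is_direct_sum {z. \<phi> (skew_partial_prod d x i) z = 0} {0..i} (\<lambda>j. ac_line (Y i j))"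
    by metis
  have "\<exists>y :: nat \<Rightarrow> nat \<Rightarrow> 'a alg_closure. y d 0 = 1 \<and>
      (\<forall>i\<in>{0..d-1}.
        inj_on (y (d - i)) {0..i} \<and> ac.independent (y (d - i) ` {0..i}) \<and>
        is_direct_sum {z. \<phi> (skew_partial_prod d x i) z = 0} {0..i} (\<lambda>j. ac_line (y (d - i) j)))"
  \<comment> \<open>The bases in \<open>Y\<close> are indexed by the number of factors minus one,
    those of the statement by d - i; the reflection k -> d - k passes from one to the other.\<close>
  proof (intro exI[of _ "\<lambda>k. Y (d - k)"] conjI ballI)
    fix i assume i: "i \<in> {0..d-1}"
    hence "d - (d - i) = i" using assms(1) by auto
    thus "inj_on (Y (d - (d - i))) {0..i}" "ac.independent (Y (d - (d - i)) ` {0..i})"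
      "is_direct_sum {z. \<phi> (skew_partial_prod d x i) z = 0} {0..i} (\<lambda>j. ac_line (Y (d - (d - i)) j))"
      using Y[OF i] by simp_all
  qed (use Y[of 0] in simp)
  moreover have "skew_partial_prod d x i \<in> skew_polys_over L" if "i \<in> {0..d-1}" for i
    by (rule skew_partial_prod_in_skew_polys_over[OF L]) (use mem that assms(1) in auto)
  moreover have "skew_factor (x k) \<in> skew_polys_over L" if "k \<in> {1..d}" for k
    using mem[OF that] by (intro skew_factor_in_skew_polys_over[OF L]) simp
  moreover have "\<forall>k\<in>{1..d-1}. x k \<in> L - {0}"
    by (intro ballI mem) auto
  moreover have "x d = 1"
    by (simp add: x_def)
  ultimately show ?thesis
    using xs(3) prod by (intro exI[of _ x]) simp
qed

end
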